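(* Let $\varepsilon>0$ and $\bar p\in(0,1)$. Assume that for every $\beta\in[1-\bar p,1)$ there is a constant $\tau_f=\tau_f(\beta)<\frac12\sqrt{\frac{\varepsilon}{1-\beta}}$ such that, for every $k$, almost surely $$\mathbb{P}\left(\{|F_k-f(X_k)|\le\tau_f\Delta_k^2\}\cap\{|F_k^g-f(X_k+\Delta_kG_k)|\le\tau_f\Delta_k^2\}\,\middle|\,\mathcal{F}_{k-1}\right)\ge\beta .$$ Then, for every $k$ and every $\alpha>0$, almost surely $$\mathbb{P}\left(|F_k-F_k^g-(f(X_k)-f(X_k+\Delta_kG_k))|\ge \alpha\Delta_k^{q}\,\middle|\,\mathcal{F}_{k-1}\right)\le\frac{\varepsilon_q}{\alpha^{q/(q-1)}}$$ with $q=2$ and $\varepsilon_q=\frac{\varepsilon}{\bar p}$.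
   Context: $f:\mathbb{R}^n\to\mathbb{R}$ is locally Lipschitz continuous with $\inf f=f^*\in\mathbb{R}$. On a probability space, a stochastic derivative-free algorithm generates, for $k=0,1,2,\dots$, random iterates $X_k\in\mathbb{R}^n$, random stepsizes $\Delta_k>0$, random directions $G_k\in\mathbb{R}^n$, and real random variables $F_k$, $F_k^g$ which are estimates of $f(X_k)$ and $f(X_k+\Delta_kG_k)$ respectively. $\mathcal{F}_{k-1}$ is the $\sigma$-algebra generated by $(F_j,F_j^g)_{j=0}^{k-1}$ and $(G_j)_{j=0}^{k}$. $X_0$ and $\Delta_0$ are deterministic and $(X_{k+1},\Delta_{k+1})$ is determined by $(X_k,\Delta_k,G_k,F_k,F_k^g)$, so $X_k,\Delta_k,G_k$ are $\mathcal{F}_{k-1}$-measurable. *)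

theory Defs
  imports "HOL-Probability.Probability"
begin

definition locally_lipschitz :: "('a::metric_space \<Rightarrow> 'b::metric_space) \<Rightarrow> bool" where
  "locally_lipschitz f \<longleftrightarrow> (\<forall>x. \<exists>r>0. \<exists>L. L-lipschitz_on (ball x r) f)"

text \<open>
  \<open>history M F Fg G k\<close> is the sub-\<open>\<sigma>\<close>-algebra usually written with index \<open>k - 1\<close>: it is generated
  by the function estimates of the iterations before \<open>k\<close> and by the directions up to and including
  the one of iteration \<open>k\<close>. The index is shifted so that \<open>k = 0\<close> needs no special treatment.
\<close>

definition history ::
  "'a measure \<Rightarrow> (nat \<Rightarrow> 'a \<Rightarrow> real) \<Rightarrow> (nat \<Rightarrow> 'a \<Rightarrow> real) \<Rightarrow>
   (nat \<Rightarrow> 'a \<Rightarrow> 'b::topological_space) \<Rightarrow> nat \<Rightarrow> 'a measure" where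
  "history M F Fg G k = sigma (space M)
     ({F j -` A \<inter> space M | j A. j < k \<and> A \<in> sets borel} \<union>
      {Fg j -` A \<inter> space M | j A. j < k \<and> A \<in> sets borel} \<union>
      {G j -` A \<inter> space M | j A. j \<le> k \<and> A \<in> sets borel})"

definition cond_probability :: "'a measure \<Rightarrow> 'a measure \<Rightarrow> 'a set \<Rightarrow> 'a \<Rightarrow> real" where
  "cond_probability M N A = real_cond_exp M N (indicator A)"

text \<open>
  The algorithm enters only through Borel update maps \<open>update k\<close>, which may depend on \<open>k\<close>, and the
  deterministic initial values \<open>x0\<close> and \<open>\<delta>0\<close>. Measurability of the iterates and stepsizes with
  respect to \<^const>\<open>history\<close> is a consequence, proved below.
\<close>

locale stochastic_dfo = prob_space M
  for M :: "'a measure" +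
  fixes f :: "real ^ 'n \<Rightarrow> real"
    and fstar :: real
    and x0 :: "real ^ 'n"
    and \<delta>0 :: real
    and update ::
      "nat \<Rightarrow> (real ^ 'n) \<times> real \<times> (real ^ 'n) \<times> real \<times> real \<Rightarrow> (real ^ 'n) \<times> real"
    and X :: "nat \<Rightarrow> 'a \<Rightarrow> real ^ 'n"
    and \<Delta> :: "nat \<Rightarrow> 'a \<Rightarrow> real"
    and G :: "nat \<Rightarrow> 'a \<Rightarrow> real ^ 'n"
    and F :: "nat \<Rightarrow> 'a \<Rightarrow> real"
    and Fg :: "nat \<Rightarrow> 'a \<Rightarrow> real"
  assumes f_locally_lipschitz: "locally_lipschitz f"
    and f_bdd_below: "bdd_below (range f)"
    and f_inf: "(INF x. f x) = fstar"
    and G_measurable: "\<And>k. random_variable borel (G k)"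
    and F_measurable: "\<And>k. random_variable borel (F k)"
    and Fg_measurable: "\<And>k. random_variable borel (Fg k)"
    and update_measurable: "\<And>k. update k \<in> borel \<rightarrow>\<^sub>M borel"
    and X_0: "\<And>\<omega>. \<omega> \<in> space M \<Longrightarrow> X 0 \<omega> = x0"
    and \<Delta>_0: "\<And>\<omega>. \<omega> \<in> space M \<Longrightarrow> \<Delta> 0 \<omega> = \<delta>0"
    and step: "\<And>k \<omega>. \<omega> \<in> space M \<Longrightarrow>
      (X (Suc k) \<omega>, \<Delta> (Suc k) \<omega>) = update k (X k \<omega>, \<Delta> k \<omega>, G k \<omega>, F k \<omega>, Fg k \<omega>)"
    and \<Delta>_pos: "\<And>k \<omega>. \<omega> \<in> space M \<Longrightarrow> \<Delta> k \<omega> > 0"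
begin

abbreviation \<F> :: "nat \<Rightarrow> 'a measure" where
  "\<F> \<equiv> history M F Fg G"

lemma space_history [simp]: "space (\<F> k) = space M"
  by (simp add: history_def space_measure_of_conv)

lemma sets_history:
  "sets (\<F> k) = sigma_sets (space M)
     ({F j -` A \<inter> space M | j A. j < k \<and> A \<in> sets borel} \<union>
      {Fg j -` A \<inter> space M | j A. j < k \<and> A \<in> sets borel} \<union>
      {G j -` A \<inter> space M | j A. j \<le> k \<and> A \<in> sets borel})"
  unfolding history_def by (rule sets_measure_of) auto

lemma subalgebra_history: "subalgebra M (\<F> k)"
proof -
  have "sets (\<F> k) \<subseteq> sets M"
    unfolding sets_history
    using F_measurable Fg_measurable G_measurable
    by (intro sets.sigma_sets_subset) (auto intro: measurable_sets)
  then show ?thesis by (simp add: subalgebra_def)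
qed

lemma F_history: "j < k \<Longrightarrow> F j \<in> borel_measurable (\<F> k)"
  by (intro measurableI) (auto simp: sets_history intro!: sigma_sets.Basic)

lemma Fg_history: "j < k \<Longrightarrow> Fg j \<in> borel_measurable (\<F> k)"
  by (intro measurableI) (auto simp: sets_history intro!: sigma_sets.Basic)

lemma G_history: "j \<le> k \<Longrightarrow> G j \<in> borel_measurable (\<F> k)"
  by (intro measurableI) (auto simp: sets_history intro!: sigma_sets.Basic)

lemma X_\<Delta>_history_aux:
  "j \<le> k \<Longrightarrow> (\<lambda>\<omega>. (X j \<omega>, \<Delta> j \<omega>)) \<in> borel_measurable (\<F> k)"
proof (induction j)
  case 0
  have "(\<lambda>\<omega>. (x0, \<delta>0)) \<in> borel_measurable (\<F> k)" by simp
  then show ?case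
    by (subst measurable_cong[where g = "\<lambda>\<omega>. (x0, \<delta>0)"]) (auto simp: X_0 \<Delta>_0)
next
  case (Suc j)
  then have IH: "(\<lambda>\<omega>. (X j \<omega>, \<Delta> j \<omega>)) \<in> borel_measurable (\<F> k)" by simp
  have X: "X j \<in> borel_measurable (\<F> k)" and D: "\<Delta> j \<in> borel_measurable (\<F> k)"
    using measurable_compose[OF IH[unfolded borel_prod[symmetric]] measurable_fst]
      measurable_compose[OF IH[unfolded borel_prod[symmetric]] measurable_snd] by simp_all
  have "(\<lambda>\<omega>. (X j \<omega>, \<Delta> j \<omega>, G j \<omega>, F j \<omega>, Fg j \<omega>)) \<in> borel_measurable (\<F> k)"
    using X D G_history[of j k] F_history[of j k] Fg_history[of j k] Suc.prems
    by (intro borel_measurable_Pair) auto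
  from measurable_compose[OF this update_measurable[of j]] show ?case
    by (subst measurable_cong[OF step]) auto
qed

lemma X_history: "X k \<in> borel_measurable (\<F> k)"
  and \<Delta>_history: "\<Delta> k \<in> borel_measurable (\<F> k)"
  using measurable_compose[OF X_\<Delta>_history_aux[of k k, unfolded borel_prod[symmetric]] measurable_fst]
    measurable_compose[OF X_\<Delta>_history_aux[of k k, unfolded borel_prod[symmetric]] measurable_snd]
  by simp_all

end

end

theory Submission
  imports Defs
begin

text \<open>
  On the event that both estimates have error at most \<open>\<tau> \<Delta>\<^sub>k\<^sup>2\<close>, the error of their difference is at
  most \<open>2 \<tau> \<Delta>\<^sub>k\<^sup>2\<close>. If \<open>\<tau> < \<alpha> / 2\<close>, this event is therefore disjoint from the tail event
  that the error of the difference is at least \<open>\<alpha> \<Delta>\<^sub>k\<^sup>2\<close>, so the latter has conditional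
  probability at most \<open>1 - \<beta>\<close> whenever the former has at least \<open>\<beta>\<close>.

  For a given \<open>\<alpha>\<close> the level \<open>\<beta> = 1 - \<epsilon> / \<alpha>\<^sup>2\<close> is exactly the one for which the bound on the
  accuracy constant becomes \<open>\<tau> < \<alpha> / 2\<close>, and \<open>1 - \<beta> = \<epsilon> / \<alpha>\<^sup>2\<close> is the required tail, up to the
  factor \<open>1 / pbar \<ge> 1\<close>. That level is available only if \<open>\<epsilon> / \<alpha>\<^sup>2 \<le> pbar\<close>; for smaller \<open>\<alpha>\<close> the
  claimed bound \<open>\<epsilon> / (pbar \<alpha>\<^sup>2)\<close> exceeds 1 and is trivial, and this is where the factor
  \<open>1 / pbar\<close> comes from.
\<close>

lemma locally_lipschitz_imp_continuous_on:
  assumes "locally_lipschitz f"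
  shows "continuous_on UNIV f"
proof -
  have "isCont f x" for x
  proof -
    obtain r L where "r > 0" and L: "L-lipschitz_on (ball x r) f"
      using assms unfolding locally_lipschitz_def by blast
    then have "x \<in> ball x r" by simp
    with lipschitz_on_continuous_on[OF L] show ?thesis
      by (simp add: continuous_on_eq_continuous_at)
  qed
  then show ?thesis by (simp add: continuous_on_eq_continuous_at)
qed

lemma (in prob_space) finite_measure_subalgebra:
  "subalgebra M N \<Longrightarrow> finite_measure_subalgebra M N"
  by unfold_locales

text \<open>
  Disjointness gives \<open>indicator A \<le> 1 - indicator B\<close>, and conditional expectation is monotone and
  linear.
\<close>

lemma (in prob_space) cond_probability_le_of_disjoint:
  assumes N: "subalgebra M N"
    and A: "A \<in> events" and B: "B \<in> events" and "A \<inter> B = {}"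
    and \<beta>: "AE \<omega> in M. cond_probability M N B \<omega> \<ge> \<beta>"
  shows "AE \<omega> in M. cond_probability M N A \<omega> \<le> 1 - \<beta>"
proof -
  interpret finite_measure_subalgebra M N
    using N by (rule finite_measure_subalgebra)
  have iA: "integrable M (indicator A :: 'a \<Rightarrow> real)"
    and iB: "integrable M (indicator B :: 'a \<Rightarrow> real)"
    using A B by (auto simp: less_top[symmetric])
  have "AE \<omega> in M. real_cond_exp M N (indicator A) \<omega>
      \<le> real_cond_exp M N (\<lambda>\<omega>. 1 - indicator B \<omega>) \<omega>"
    using \<open>A \<inter> B = {}\<close> iA iB
    by (intro real_cond_exp_mono) (auto split: split_indicator)
  moreover have "AE \<omega> in M. real_cond_exp M N (\<lambda>\<omega>. 1 - indicator B \<omega>) \<omega>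
      = real_cond_exp M N (\<lambda>\<omega>. 1) \<omega> - real_cond_exp M N (indicator B) \<omega>"
    using iB by (intro real_cond_exp_diff) auto
  moreover have "AE \<omega> in M. real_cond_exp M N (\<lambda>\<omega>. 1) \<omega> = 1"
    by (rule real_cond_exp_F_meas) auto
  ultimately show ?thesis
    using \<beta> unfolding cond_probability_def by eventually_elim simp
qed

lemma (in prob_space) cond_probability_le_1:
  assumes "subalgebra M N" and "A \<in> events"
  shows "AE \<omega> in M. cond_probability M N A \<omega> \<le> 1"
proof -
  interpret finite_measure_subalgebra M N
    using assms(1) by (rule finite_measure_subalgebra)
  show ?thesis
    unfolding cond_probability_def using assms(2)
    by (intro real_cond_exp_le_c) (auto simp: less_top[symmetric])
qed

context stochastic_dfo
begin

lemma X_measurable: "X k \<in> borel_measurable M"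
  and \<Delta>_measurable: "\<Delta> k \<in> borel_measurable M"
  using measurable_from_subalg[OF subalgebra_history] X_history \<Delta>_history by blast+

lemma f_measurable: "f \<in> borel_measurable borel"
  using locally_lipschitz_imp_continuous_on[OF f_locally_lipschitz]
  by (rule borel_measurable_continuous_onI)

lemmas iteration_measurable [measurable] =
  f_measurable X_measurable \<Delta>_measurable G_measurable F_measurable Fg_measurable

definition accurate :: "nat \<Rightarrow> real \<Rightarrow> 'a set" where
  "accurate k \<tau> =
    {\<omega> \<in> space M. \<bar>F k \<omega> - f (X k \<omega>)\<bar> \<le> \<tau> * (\<Delta> k \<omega>)\<^sup>2} \<inter>
    {\<omega> \<in> space M. \<bar>Fg k \<omega> - f (X k \<omega> + \<Delta> k \<omega> *\<^sub>R G k \<omega>)\<bar> \<le> \<tau> * (\<Delta> k \<omega>)\<^sup>2}"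

definition difference_error_ge :: "nat \<Rightarrow> real \<Rightarrow> 'a set" where
  "difference_error_ge k \<alpha> =
    {\<omega> \<in> space M.
      \<bar>F k \<omega> - Fg k \<omega> - (f (X k \<omega>) - f (X k \<omega> + \<Delta> k \<omega> *\<^sub>R G k \<omega>))\<bar> \<ge> \<alpha> * (\<Delta> k \<omega>)\<^sup>2}"

lemma accurate_event: "accurate k \<tau> \<in> events"
  unfolding accurate_def by measurable

lemma difference_error_ge_event: "difference_error_ge k \<alpha> \<in> events"
  unfolding difference_error_ge_def by measurable

text \<open>
  The triangle inequality; positivity of the stepsize makes \<open>2 \<tau> \<Delta>\<^sub>k\<^sup>2 < \<alpha> \<Delta>\<^sub>k\<^sup>2\<close> strict.
\<close>

lemma difference_error_ge_disjoint_accurate: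
  assumes "2 * \<tau> < \<alpha>"
  shows "difference_error_ge k \<alpha> \<inter> accurate k \<tau> = {}"
proof -
  have "2 * \<tau> * (\<Delta> k \<omega>)\<^sup>2 < \<alpha> * (\<Delta> k \<omega>)\<^sup>2" if "\<omega> \<in> space M" for \<omega>
    using assms \<Delta>_pos[OF that, of k] by (intro mult_strict_right_mono) auto
  then show ?thesis
    unfolding difference_error_ge_def accurate_def by (fastforce simp: abs_if split: if_splits)
qed

text \<open>
  The case distinction is whether the level \<open>\<beta> = 1 - \<epsilon> / \<alpha>\<^sup>2\<close> lies in the range \<open>[1 - p, 1)\<close> on which
  accuracy is assumed.
\<close>

lemma cond_probability_difference_error_le:
  assumes "\<epsilon> > 0" and "0 < p" and "p < 1" and "\<alpha> > 0"
    and accuracy: "\<And>\<beta>. \<beta> \<in> {1 - p..<1} \<Longrightarrow>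
      \<exists>\<tau> < 1/2 * sqrt (\<epsilon> / (1 - \<beta>)). AE \<omega> in M. cond_probability M (\<F> k) (accurate k \<tau>) \<omega> \<ge> \<beta>"
  shows "AE \<omega> in M. cond_probability M (\<F> k) (difference_error_ge k \<alpha>) \<omega> \<le> \<epsilon> / p / \<alpha>\<^sup>2"
proof (cases "\<epsilon> / \<alpha>\<^sup>2 \<le> p")
  case True
  define \<beta> where "\<beta> = 1 - \<epsilon> / \<alpha>\<^sup>2"
  have "\<epsilon> / \<alpha>\<^sup>2 > 0"
    using \<open>\<epsilon> > 0\<close> \<open>\<alpha> > 0\<close> by simp
  with True have "\<beta> \<in> {1 - p..<1}"
    by (simp add: \<beta>_def)
  then obtain \<tau> where \<tau>: "\<tau> < 1/2 * sqrt (\<epsilon> / (1 - \<beta>))"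
    and acc: "AE \<omega> in M. cond_probability M (\<F> k) (accurate k \<tau>) \<omega> \<ge> \<beta>"
    using accuracy by blast
  have "sqrt (\<epsilon> / (1 - \<beta>)) = \<alpha>"
    using \<open>\<epsilon> > 0\<close> \<open>\<alpha> > 0\<close> by (simp add: \<beta>_def)
  with \<tau> have "2 * \<tau> < \<alpha>" by simp
  then have "AE \<omega> in M. cond_probability M (\<F> k) (difference_error_ge k \<alpha>) \<omega> \<le> 1 - \<beta>"
    using difference_error_ge_disjoint_accurate acc
    by (intro cond_probability_le_of_disjoint[OF subalgebra_history])
       (auto intro: accurate_event difference_error_ge_event)
  moreover have "1 - \<beta> \<le> \<epsilon> / p / \<alpha>\<^sup>2"
  proof -
    have "\<epsilon> * p \<le> \<epsilon>"
      using \<open>\<epsilon> > 0\<close> \<open>p < 1\<close> by simp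
    then have "\<epsilon> \<le> \<epsilon> / p"
      using \<open>0 < p\<close> by (simp add: pos_le_divide_eq)
    then have "\<epsilon> / \<alpha>\<^sup>2 \<le> \<epsilon> / p / \<alpha>\<^sup>2"
      by (rule divide_right_mono) simp
    then show ?thesis
      by (simp add: \<beta>_def)
  qed
  ultimately show ?thesis by (auto elim: eventually_mono)
next
  case False
  then have bound: "1 \<le> \<epsilon> / p / \<alpha>\<^sup>2"
    using \<open>0 < p\<close> \<open>\<alpha> > 0\<close> by (simp add: field_simps)
  from cond_probability_le_1[OF subalgebra_history difference_error_ge_event, of k k \<alpha>]
  show ?thesis by (rule eventually_mono) (rule order_trans[OF _ bound])
qed

end

theorem proposition2p12:
  fixes M :: "'a measure"
    and f :: "real ^ 'n \<Rightarrow> real"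
    and fstar :: real
    and x0 :: "real ^ 'n"
    and \<delta>0 :: real
    and update ::
      "nat \<Rightarrow> (real ^ 'n) \<times> real \<times> (real ^ 'n) \<times> real \<times> real \<Rightarrow> (real ^ 'n) \<times> real"
    and X G :: "nat \<Rightarrow> 'a \<Rightarrow> real ^ 'n"
    and \<Delta> F Fg :: "nat \<Rightarrow> 'a \<Rightarrow> real"
    and \<epsilon> pbar q \<epsilon>q :: real
  assumes algorithm: "stochastic_dfo M f fstar x0 \<delta>0 update X \<Delta> G F Fg"
    and "\<epsilon> > 0"
    and "0 < pbar" and "pbar < 1"
    and accuracy: "\<forall>\<beta>\<in>{1 - pbar..<1}. \<exists>\<tau>f < 1/2 * sqrt (\<epsilon> / (1 - \<beta>)). \<forall>k.
      AE \<omega> in M.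
        cond_probability M (history M F Fg G k)
          ({\<omega> \<in> space M. \<bar>F k \<omega> - f (X k \<omega>)\<bar> \<le> \<tau>f * (\<Delta> k \<omega>)\<^sup>2} \<inter>
           {\<omega> \<in> space M. \<bar>Fg k \<omega> - f (X k \<omega> + \<Delta> k \<omega> *\<^sub>R G k \<omega>)\<bar> \<le> \<tau>f * (\<Delta> k \<omega>)\<^sup>2}) \<omega> \<ge> \<beta>"
    and "q = 2" and "\<epsilon>q = \<epsilon> / pbar"
  shows "\<forall>k. \<forall>\<alpha>>0. AE \<omega> in M.
    cond_probability M (history M F Fg G k)
      {\<omega> \<in> space M.
        \<bar>F k \<omega> - Fg k \<omega> - (f (X k \<omega>) - f (X k \<omega> + \<Delta> k \<omega> *\<^sub>R G k \<omega>))\<bar> \<ge> \<alpha> * \<Delta> k \<omega> powr q} \<omega>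
      \<le> \<epsilon>q / \<alpha> powr (q / (q - 1))"
proof (intro allI impI)
  fix k :: nat and \<alpha> :: real
  assume "\<alpha> > 0"
  interpret stochastic_dfo M f fstar x0 \<delta>0 update X \<Delta> G F Fg
    by (rule algorithm)
  have "AE \<omega> in M. cond_probability M (\<F> k) (difference_error_ge k \<alpha>) \<omega> \<le> \<epsilon> / pbar / \<alpha>\<^sup>2"
    using \<open>\<epsilon> > 0\<close> \<open>0 < pbar\<close> \<open>pbar < 1\<close> \<open>\<alpha> > 0\<close>
  proof (rule cond_probability_difference_error_le)
    fix \<beta> assume "\<beta> \<in> {1 - pbar..<1}"
    with accuracy show "\<exists>\<tau> < 1/2 * sqrt (\<epsilon> / (1 - \<beta>)).
        AE \<omega> in M. cond_probability M (\<F> k) (accurate k \<tau>) \<omega> \<ge> \<beta>"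
      unfolding accurate_def by blast
  qed
  moreover have "difference_error_ge k \<alpha> = {\<omega> \<in> space M.
      \<bar>F k \<omega> - Fg k \<omega> - (f (X k \<omega>) - f (X k \<omega> + \<Delta> k \<omega> *\<^sub>R G k \<omega>))\<bar> \<ge> \<alpha> * \<Delta> k \<omega> powr q}"
    unfolding difference_error_ge_def \<open>q = 2\<close>
    by (intro Collect_cong conj_cong refl) (simp add: \<Delta>_pos less_imp_le)
  moreover have "\<alpha> powr (q / (q - 1)) = \<alpha>\<^sup>2"
    using \<open>\<alpha> > 0\<close> by (simp add: \<open>q = 2\<close> powr_numeral)
  ultimately show "AE \<omega> in M.
    cond_probability M (history M F Fg G k)
      {\<omega> \<in> space M.
        \<bar>F k \<omega> - Fg k \<omega> - (f (X k \<omega>) - f (X k \<omega> + \<Delta> k \<omega> *\<^sub>R G k \<omega>))\<bar> \<ge> \<alpha> * \<Delta> k \<omega> powr q} \<omega>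
      \<le> \<epsilon>q / \<alpha> powr (q / (q - 1))"
    by (simp add: \<open>\<epsilon>q = \<epsilon> / pbar\<close>)
qed

end
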